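(* Every left separative left legal semigroup is commutative.
   Context: A semigroup is left legal if it satisfies the identity $aba=ab$. A semigroup $S$ is left separative if, for all $a,b\in S$, $ab=a^2$ and $ba=b^2$ together imply $a=b$. *)

theory Defs
  imports Main
begin

locale left_legal_semigroup = semigroup +
  assumes left_legal: "a \<^bold>* b \<^bold>* a = a \<^bold>* b"

locale left_separative_semigroup = semigroup +
  assumes left_separative: "a \<^bold>* b = a \<^bold>* a \<Longrightarrow> b \<^bold>* a = b \<^bold>* b \<Longrightarrow> a = b"

end

theory Submission
  imports Defs
begin

text \<open>Left legality makes x = ab and y = ba satisfy xy = xx; exchanging a and b gives yx = yy.
  These are the premises of left separativity, so ab = ba.\<close>

text \<open>Left separativity applied to the elements \<open>ab\<close> and \<open>ba\<close>:
  left legality gives \<open>ab \<cdot> ba = a(bb)a = abb = (aba)b = (ab)(ab)\<close>.\<close>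

lemma (in left_legal_semigroup) mult_swap_eq_square:
  "(a \<^bold>* b) \<^bold>* (b \<^bold>* a) = (a \<^bold>* b) \<^bold>* (a \<^bold>* b)"
proof -
  have "(a \<^bold>* b) \<^bold>* (b \<^bold>* a) = a \<^bold>* (b \<^bold>* b) \<^bold>* a"
    by (simp only: assoc)
  \<comment> \<open>Left legality with the square bb in place of \<open>b\<close>.\<close>
  also have "\<dots> = a \<^bold>* b \<^bold>* b"
    by (simp only: left_legal) (simp only: assoc)
  also have "\<dots> = a \<^bold>* b \<^bold>* a \<^bold>* b"
    by (simp only: left_legal)
  also have "\<dots> = (a \<^bold>* b) \<^bold>* (a \<^bold>* b)"
    by (simp only: assoc)
  finally show ?thesis .
qed

theorem theorem13:
  fixes f :: "'a \<Rightarrow> 'a \<Rightarrow> 'a"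
  assumes "left_separative_semigroup f" and "left_legal_semigroup f"
  shows "abel_semigroup f"
proof -
  interpret left_separative_semigroup f by fact
  interpret left_legal_semigroup f by fact
  show ?thesis
    \<comment> \<open>Only commutativity is left to show; the second use of
      \<open>mult_swap_eq_square\<close> has the roles of a and b exchanged.\<close>
    by unfold_locales (rule left_separative[OF mult_swap_eq_square mult_swap_eq_square])
qed

end
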